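(* Let $d\ge 2$ be an integer, $X=\{0,1,\ldots,d-1\}$, and let $f(x)\in\mathbb{Z}[x]$. Then $f$ induces an endomorphism of the rooted $d$-ary tree $X^*$. Moreover, different polynomials in $\mathbb{Z}[x]$ induce different endomorphisms of $X^*$.
   Context: Tree: $X^*$ is the set of all finite words over $X=\{0,1,\ldots,d-1\}$, viewed as a rooted $d$-ary tree in which each word $v$ is adjacent to $vx$ for $x\in X$; the root is the empty word and the $n$-th level is $X^n$. The level $X^n$ is identified with $\mathbb{Z}/d^n\mathbb{Z}$ via $x_0x_1\ldots x_{n-1}\mapsto x_0+dx_1+\cdots+d^{n-1}x_{n-1}$. Induced map: a polynomial $f\in\mathbb{Z}[x]$ induces evaluation maps $f_n:\mathbb{Z}/d^n\mathbb{Z}\to\mathbb{Z}/d^n\mathbb{Z}$ for all $n\ge 1$, and hence, via the identification above (and fixing the root), a map on the set of vertices of $X^*$ sending each level to itself. This is the map induced by $f$ on $X^*$. Endomorphism: an endomorphism of $X^*$ is a map from the set of vertices of $X^*$ to itself which preserves the adjacency relation. *)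

theory Defs
  imports "HOL-Computational_Algebra.Polynomial" "HOL-Library.FuncSet"
begin

definition tree_vertices :: "nat \<Rightarrow> nat list set" where
  "tree_vertices d = lists {..<d}"

definition tree_level :: "nat \<Rightarrow> nat \<Rightarrow> nat list set" where
  "tree_level d n = {w \<in> tree_vertices d. length w = n}"

definition tree_adj :: "nat \<Rightarrow> nat list \<Rightarrow> nat list \<Rightarrow> bool" where
  "tree_adj d u v \<longleftrightarrow> u \<in> tree_vertices d \<and> v \<in> tree_vertices d \<and>
     (\<exists>x<d. v = u @ [x] \<or> u = v @ [x])"

text \<open>The maps on vertices are taken extensional (undefined outside the vertex set), so that
  equality of functions is equality on vertices.\<close>

definition tree_endomorphism :: "nat \<Rightarrow> (nat list \<Rightarrow> nat list) \<Rightarrow> bool" where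
  "tree_endomorphism d \<phi> \<longleftrightarrow> \<phi> \<in> tree_vertices d \<rightarrow>\<^sub>E tree_vertices d \<and>
     (\<forall>u\<in>tree_vertices d. \<forall>v\<in>tree_vertices d. tree_adj d u v \<longrightarrow> tree_adj d (\<phi> u) (\<phi> v))"

text \<open>The ring of integers modulo \<open>d ^ n\<close> is represented by the canonical residues
  \<open>{0..<int d ^ n}\<close>; the first letter of a word is the least significant digit.\<close>

definition word_residue :: "nat \<Rightarrow> nat list \<Rightarrow> int" where
  "word_residue d w = (\<Sum>i<length w. int d ^ i * int (w ! i))"

definition residue_word :: "nat \<Rightarrow> nat \<Rightarrow> int \<Rightarrow> nat list" where
  "residue_word d n = inv_into (tree_level d n) (word_residue d)"

definition eval_mod :: "nat \<Rightarrow> nat \<Rightarrow> int poly \<Rightarrow> int \<Rightarrow> int" where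
  "eval_mod d n f r = poly f r mod int d ^ n"

definition induced_map :: "nat \<Rightarrow> int poly \<Rightarrow> nat list \<Rightarrow> nat list" where
  "induced_map d f = (\<lambda>v\<in>tree_vertices d.
     residue_word d (length v) (eval_mod d (length v) f (word_residue d v)))"

lemma word_residue_Nil [simp]: "word_residue d [] = 0"
  by (simp add: word_residue_def)

lemma word_residue_Cons [simp]:
  "word_residue d (x # w) = int x + int d * word_residue d w"
  unfolding word_residue_def
  by (simp add: sum.lessThan_Suc_shift sum_distrib_left mult.assoc del: sum.lessThan_Suc)

lemma bij_betw_word_residue:
  assumes "d \<ge> 2"
  shows "bij_betw (word_residue d) (tree_level d n) {0..<int d ^ n}"
proof (induction n)
  case 0
  show ?case by (auto simp: bij_betw_def inj_on_def tree_level_def tree_vertices_def)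
next
  case (Suc n)
  have mem: "w \<in> tree_level d (Suc n) \<longleftrightarrow> (\<exists>x u. w = x # u \<and> x < d \<and> u \<in> tree_level d n)" for w
    by (cases w) (auto simp: tree_level_def tree_vertices_def)
  have rng: "0 \<le> word_residue d u \<and> word_residue d u < int d ^ n"
    if "u \<in> tree_level d n" for u
    using bij_betwE[OF Suc] that by auto
  have inj: "inj_on (word_residue d) (tree_level d (Suc n))"
  proof (rule inj_onI)
    fix v w
    assume "v \<in> tree_level d (Suc n)" "w \<in> tree_level d (Suc n)"
      and eq: "word_residue d v = word_residue d w"
    then obtain x u y t where
      v: "v = x # u" "x < d" "u \<in> tree_level d n" and w: "w = y # t" "y < d" "t \<in> tree_level d n"
      using mem by auto
    have e: "int x + int d * word_residue d u = int y + int d * word_residue d t"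
      using eq v w by simp
    have "int x = (int x + int d * word_residue d u) mod int d" using v by simp
    also have "\<dots> = int y" using e w by simp
    finally have "x = y" by simp
    with e assms have "word_residue d u = word_residue d t" by simp
    then have "u = t" using Suc v w by (meson bij_betw_def inj_onD)
    with \<open>x = y\<close> show "v = w" using v w by simp
  qed
  have "word_residue d ` tree_level d (Suc n) = {0..<int d ^ Suc n}"
  proof
    show "word_residue d ` tree_level d (Suc n) \<subseteq> {0..<int d ^ Suc n}"
    proof
      fix r assume "r \<in> word_residue d ` tree_level d (Suc n)"
      then obtain x u where r: "r = int x + int d * word_residue d u"
        and x: "x < d" and u: "u \<in> tree_level d n"
        using mem by auto
      have "int d * (word_residue d u + 1) \<le> int d * int d ^ n"
        using rng[OF u] by (intro mult_left_mono) auto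
      then show "r \<in> {0..<int d ^ Suc n}"
        using r x rng[OF u] by (auto simp: algebra_simps)
    qed
    show "{0..<int d ^ Suc n} \<subseteq> word_residue d ` tree_level d (Suc n)"
    proof
      fix r assume r: "r \<in> {0..<int d ^ Suc n}"
      have d0: "int d > 0" using assms by simp
      have "r div int d < int d ^ n"
        using r d0 by (smt (verit) atLeastLessThan_iff mult_less_cancel_left_pos
            mult_div_mod_eq pos_mod_sign power_Suc)
      moreover have "0 \<le> r div int d" using r d0 by (simp add: pos_imp_zdiv_nonneg_iff)
      ultimately have "r div int d \<in> word_residue d ` tree_level d n"
        using bij_betw_imp_surj_on[OF Suc] by simp
      then obtain u where u: "u \<in> tree_level d n" "word_residue d u = r div int d" by auto
      have x: "nat (r mod int d) < d" using d0 by (simp add: nat_less_iff)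
      have "word_residue d (nat (r mod int d) # u) = r" using u d0 by simp
      moreover have "nat (r mod int d) # u \<in> tree_level d (Suc n)" using mem x u by auto
      ultimately show "r \<in> word_residue d ` tree_level d (Suc n)" by (metis image_eqI)
    qed
  qed
  with inj show ?case by (simp add: bij_betw_def)
qed

lemma induced_map_level:
  assumes "d \<ge> 2" "v \<in> tree_level d n"
  shows "induced_map d f v \<in> tree_level d n"
    and "word_residue d (induced_map d f v) = poly f (word_residue d v) mod int d ^ n"
proof -
  have v: "v \<in> tree_vertices d" "length v = n" using assms(2) by (auto simp: tree_level_def)
  have img: "poly f (word_residue d v) mod int d ^ n \<in> word_residue d ` tree_level d n"
    using bij_betw_imp_surj_on[OF bij_betw_word_residue[OF assms(1)], of n] assms(1) by simp
  show "induced_map d f v \<in> tree_level d n"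
    "word_residue d (induced_map d f v) = poly f (word_residue d v) mod int d ^ n"
    using inv_into_into[OF img] f_inv_into_f[OF img] v
    by (simp_all add: induced_map_def residue_word_def eval_mod_def)
qed

end

theory Submission
  imports Defs
begin

text \<open>Since \<open>a - b\<close> divides \<open>f(a) - f(b)\<close>, the residue of \<open>f(r)\<close> modulo \<open>d ^ n\<close> depends only on
  the first \<open>n\<close> digits of \<open>r\<close>, so the induced map sends a child of \<open>v\<close> to a child of the image of
  \<open>v\<close>. If \<open>f\<close> and \<open>g\<close> induce the same map, then for each natural number \<open>r\<close> the value
  \<open>f(r) - g(r)\<close> is divisible by every sufficiently high power of \<open>d\<close>, hence is zero; so \<open>f - g\<close> has
  infinitely many roots.\<close>

text \<open>Horner induction: the constant term cancels, and \<open>a * p(a) - b * p(b)\<close>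
  splits into \<open>a * (p(a) - p(b))\<close>, covered by the induction hypothesis, and an explicit
  multiple of \<open>a - b\<close>.\<close>

lemma diff_dvd_poly_diff:
  fixes p :: "'a::comm_ring_1 poly"
  shows "a - b dvd poly p a - poly p b"
proof (induction p)
  case 0
  show ?case by simp
next
  case (pCons c p)
  have "poly (pCons c p) a - poly (pCons c p) b = a * (poly p a - poly p b) + (a - b) * poly p b"
    by (simp add: algebra_simps)
  with pCons.IH show ?case by simp
qed

lemma poly_mod_eq:
  fixes p :: "int poly"
  assumes "a mod m = b mod m"
  shows "poly p a mod m = poly p b mod m"
  using assms diff_dvd_poly_diff[of a b p] by (metis dvd_trans mod_eq_dvd_iff)

lemma word_residue_snoc:
  "word_residue d (w @ [x]) = word_residue d w + int d ^ length w * int x"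
  by (induction w) (simp_all add: algebra_simps)

lemma tree_level_snoc:
  "w @ [x] \<in> tree_level d (Suc n) \<longleftrightarrow> w \<in> tree_level d n \<and> x < d"
  by (auto simp: tree_level_def tree_vertices_def)

lemma tree_level_SucE:
  assumes "w \<in> tree_level d (Suc n)"
  obtains u x where "w = u @ [x]" "u \<in> tree_level d n" "x < d"
  using assms tree_level_snoc by (cases w rule: rev_cases) (auto simp: tree_level_def)

text \<open>Reduction modulo \<open>d ^ n\<close> corresponds to passing to the parent: the last
  letter contributes a multiple of \<open>d ^ n\<close>, and what remains is already a canonical
  residue.\<close>

lemma word_residue_snoc_mod:
  assumes "d \<ge> 2" "w \<in> tree_level d n"
  shows "word_residue d (w @ [x]) mod int d ^ n = word_residue d w"
  using bij_betwE[OF bij_betw_word_residue[OF assms(1)]] assms(2)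
  by (auto simp: word_residue_snoc tree_level_def)

lemma induced_map_snoc:
  assumes d: "d \<ge> 2" and v: "v \<in> tree_level d n" and x: "x < d"
  obtains y where "y < d" "induced_map d f (v @ [x]) = induced_map d f v @ [y]"
proof -
  have vx: "v @ [x] \<in> tree_level d (Suc n)"
    using v x by (simp add: tree_level_snoc)
  obtain u y where u: "induced_map d f (v @ [x]) = u @ [y]" "u \<in> tree_level d n" "y < d"
    using tree_level_SucE[OF induced_map_level(1)[OF d vx]] .
  \<comment> \<open>The parent \<open>u\<close> of the image is identified with the image of
    \<open>v\<close> by comparing residues modulo \<open>d ^ n\<close>, which determine a word of
    level \<open>n\<close>.\<close>
  have "word_residue d u = word_residue d (induced_map d f (v @ [x])) mod int d ^ n"
    using word_residue_snoc_mod[OF d u(2)] u(1) by simp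
  also have "\<dots> = poly f (word_residue d (v @ [x])) mod int d ^ Suc n mod int d ^ n"
    using induced_map_level(2)[OF d vx] by simp
  also have "\<dots> = poly f (word_residue d (v @ [x])) mod int d ^ n"
    by (simp add: mod_mod_cancel)
  also have "\<dots> = poly f (word_residue d v) mod int d ^ n"
    by (metis poly_mod_eq mod_mod_trivial word_residue_snoc_mod[OF d v])
  also have "\<dots> = word_residue d (induced_map d f v)"
    using induced_map_level(2)[OF d v] by simp
  finally have "u = induced_map d f v"
    using bij_betw_word_residue[OF d] u(2) induced_map_level(1)[OF d v]
    by (meson bij_betw_imp_inj_on inj_onD)
  with u that show thesis by simp
qed

lemma tree_adj_snoc:
  assumes "v \<in> tree_level d n" "x < d"
  shows "tree_adj d v (v @ [x])" "tree_adj d (v @ [x]) v"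
  using assms by (auto simp: tree_adj_def tree_level_def tree_vertices_def)

lemma tree_endomorphism_induced_map:
  assumes d: "d \<ge> 2"
  shows "tree_endomorphism d (induced_map d f)"
proof -
  have level: "v \<in> tree_level d (length v)" if "v \<in> tree_vertices d" for v
    using that by (simp add: tree_level_def)
  \<comment> \<open>Both orientations are recorded because either endpoint of an edge may be the
    child.\<close>
  have child: "tree_adj d (induced_map d f v) (induced_map d f (v @ [x]))"
    "tree_adj d (induced_map d f (v @ [x])) (induced_map d f v)"
    if v: "v \<in> tree_vertices d" and x: "x < d" for v x
  proof -
    obtain y where "y < d" "induced_map d f (v @ [x]) = induced_map d f v @ [y]"
      using induced_map_snoc[OF d level[OF v] x] .
    then show "tree_adj d (induced_map d f v) (induced_map d f (v @ [x]))"
      "tree_adj d (induced_map d f (v @ [x])) (induced_map d f v)"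
      using tree_adj_snoc[OF induced_map_level(1)[OF d level[OF v]]] by simp_all
  qed
  show ?thesis
    unfolding tree_endomorphism_def
  proof (intro conjI ballI impI)
    show "induced_map d f \<in> tree_vertices d \<rightarrow>\<^sub>E tree_vertices d"
    proof (rule PiE_I)
      show "induced_map d f v \<in> tree_vertices d" if "v \<in> tree_vertices d" for v
        using induced_map_level(1)[OF d level[OF that]] by (simp add: tree_level_def)
    qed (simp add: induced_map_def)
  next
    fix u v
    assume "u \<in> tree_vertices d" "v \<in> tree_vertices d" "tree_adj d u v"
    then obtain x where "x < d" "v = u @ [x] \<or> u = v @ [x]"
      by (auto simp: tree_adj_def)
    with \<open>u \<in> tree_vertices d\<close> \<open>v \<in> tree_vertices d\<close> child
    show "tree_adj d (induced_map d f u) (induced_map d f v)"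
      by auto
  qed
qed

lemma poly_eq_if_induced_map_eq:
  assumes d: "d \<ge> 2" and eq: "induced_map d f = induced_map d g"
  shows "poly f (int r) = poly g (int r)"
proof -
  define h where "h = poly f (int r) - poly g (int r)"
  \<comment> \<open>A level deep enough for two purposes: \<open>r\<close> is a canonical residue
    there, hence comes from a word, and \<open>d ^ n\<close> exceeds the absolute value of
    \<open>h\<close>.\<close>
  define n where "n = max r (nat \<bar>h\<bar>)"
  have "n < d ^ n"
    using d by (intro power_gt_expt) simp
  then have "int n < int d ^ n"
    by (metis of_nat_less_iff of_nat_power)
  moreover have "int r \<le> int n" "\<bar>h\<bar> \<le> int n"
    by (auto simp: n_def)
  ultimately have bounds: "int r < int d ^ n" "\<bar>h\<bar> < int d ^ n"
    by linarith+
  then have "int r \<in> word_residue d ` tree_level d n"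
    using bij_betw_imp_surj_on[OF bij_betw_word_residue[OF d], of n] by simp
  then obtain v where v: "v \<in> tree_level d n" "word_residue d v = int r"
    by auto
  have "poly f (int r) mod int d ^ n = poly g (int r) mod int d ^ n"
    using induced_map_level(2)[OF d v(1), of f] induced_map_level(2)[OF d v(1), of g] eq v(2)
    by simp
  then have "int d ^ n dvd h"
    by (simp add: h_def mod_eq_dvd_iff)
  \<comment> \<open>A nonzero multiple of \<open>d ^ n\<close> has absolute value at least
    \<open>d ^ n\<close>.\<close>
  with bounds(2) have "h = 0"
    using dvd_imp_le_int[of h "int d ^ n"] by linarith
  then show ?thesis
    by (simp add: h_def)
qed

text \<open>A nonzero difference has finitely many roots over an integral domain, whereas in
  characteristic zero the natural numbers give infinitely many.\<close>

lemma poly_eq_if_eq_on_nats: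
  fixes p q :: "'a::{idom,ring_char_0} poly"
  assumes "\<And>n. poly p (of_nat n) = poly q (of_nat n)"
  shows "p = q"
proof (rule ccontr)
  assume "p \<noteq> q"
  then have "finite {x. poly (p - q) x = 0}"
    by (intro poly_roots_finite) simp
  moreover have "range of_nat \<subseteq> {x. poly (p - q) x = 0}"
    using assms by auto
  ultimately have "finite (range (of_nat :: nat \<Rightarrow> 'a))"
    by (rule rev_finite_subset)
  then show False
    by (simp add: finite_image_iff inj_of_nat)
qed

theorem proposition3p1:
  fixes d :: nat
  assumes "d \<ge> 2"
  shows "(\<forall>f :: int poly. tree_endomorphism d (induced_map d f)) \<and>
         (\<forall>f g :: int poly. f \<noteq> g \<longrightarrow> induced_map d f \<noteq> induced_map d g)"
proof (intro conjI allI impI notI)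
  fix f :: "int poly"
  show "tree_endomorphism d (induced_map d f)"
    using assms by (rule tree_endomorphism_induced_map)
next
  fix f g :: "int poly"
  assume "f \<noteq> g" "induced_map d f = induced_map d g"
  then show False
    using poly_eq_if_induced_map_eq[OF assms] poly_eq_if_eq_on_nats by blast
qed

end
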